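(* Let $M$ be an oriented matroid on a finite ground set $E$ which is realizable over $\mathbb{R}$, and let $\sigma,\sigma^*$ be acyclic signatures of the circuits and of the cocircuits of $M$, respectively. For a basis $B$ of $M$ let $\hat\beta(B)$ be the orientation of $M$ in which each $e\notin B$ is oriented according to its orientation in $\sigma(C(B,e))$ and each $e\in B$ is oriented according to its orientation in $\sigma^*(C^*(B,e))$. Then the map $\hat\beta:B(M)\to\mathcal{X}(M;\sigma,\sigma^* )$ is a bijection, where $B(M)$ is the set of bases of $M$.
   Context: $M$ is realized by a real $r\times m$ matrix $A$ of rank $r$ with columns indexed by $E$. Signed circuits of $M$ are the sign vectors (in $\{0,\pm1\}^E$) of support-minimal nonzero vectors of $\ker(A)$; signed cocircuits are the sign vectors of support-minimal nonzero vectors of the row space of $A$. For each circuit (support of a signed circuit), the vectors of $\ker(A)$ supported exactly on it, together with $0$, form a line whose two open rays correspond to the two signed circuits with that support; for a signed circuit $C$ let $\mathbf{v}_C$ denote an arbitrary vector in the corresponding ray. Similarly for cocircuits with the row space in place of $\ker(A)$. A signature $\sigma$ of the circuits assigns to each (unsigned) circuit $\underline{C}$ one of the two signed circuits with support $\underline{C}$; it is acyclic if the only nonnegative reals $a_{\underline{C}}$ with $\sum_{\underline{C}}a_{\underline{C}}\mathbf{v}_{\sigma(\underline{C})}=0$ are all zero (independent of the choices of $\mathbf{v}$). Signatures $\sigma^*$ of cocircuits and acyclicity are defined analogously. For a basis $B$: $C(B,e)$ ($e\notin B$) is the unique circuit contained in $B\cup\{e\}$, and $C^*(B,e)$ ($e\in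 B$) is the unique cocircuit contained in $(E\setminus B)\cup\{e\}$. A (discrete) orientation is a function $\mathcal{O}:E\to\{-1,1\}$; orienting $e$ according to a signed (co)circuit $C$ means $\mathcal{O}(e)=C(e)$. $\mathcal{O}$ is compatible with a signed (co)circuit $C$ if $\mathcal{O}(e)=C(e)$ for all $e$ in the support of $C$. $\mathcal{X}(M;\sigma,\sigma^* )$ is the set of discrete orientations $\mathcal{O}$ such that every signed circuit compatible with $\mathcal{O}$ is of the form $\sigma(\underline{C})$ and every signed cocircuit compatible with $\mathcal{O}$ is of the form $\sigma^*(\underline{C})$. *)

theory Defs
  imports Complex_Main "HOL-Library.FuncSet"
begin

text \<open>
  The matrix has rows indexed by \<open>{..<r}\<close> and columns indexed by a finite set \<open>E\<close>; \<open>A i e\<close> is the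
  entry in row \<open>i\<close> and column \<open>e\<close>, and entries outside these ranges are irrelevant. With explicit
  carriers, \<open>r = 0\<close> and \<open>E = {}\<close> are allowed. Vectors of \<open>\<real>\<^sup>E\<close> and sign vectors are functions that
  vanish outside \<open>E\<close>.
\<close>

definition supp :: "('a \<Rightarrow> 'b::zero) \<Rightarrow> 'a set" where
  "supp v = {e. v e \<noteq> 0}"

definition sign_vec :: "('a \<Rightarrow> real) \<Rightarrow> 'a \<Rightarrow> int" where
  "sign_vec v = (\<lambda>e. if v e > 0 then 1 else if v e < 0 then - 1 else 0)"

definition matrix_kernel :: "nat \<Rightarrow> 'a set \<Rightarrow> (nat \<Rightarrow> 'a \<Rightarrow> real) \<Rightarrow> ('a \<Rightarrow> real) set" where
  "matrix_kernel r E A = {v. supp v \<subseteq> E \<and> (\<forall>i<r. (\<Sum>e\<in>E. A i e * v e) = 0)}"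

definition row_space :: "nat \<Rightarrow> 'a set \<Rightarrow> (nat \<Rightarrow> 'a \<Rightarrow> real) \<Rightarrow> ('a \<Rightarrow> real) set" where
  "row_space r E A = {v. supp v \<subseteq> E \<and> (\<exists>c. \<forall>e\<in>E. v e = (\<Sum>i<r. c i * A i e))}"

text \<open>Independence of the columns as a family: equal columns with distinct indices are dependent.\<close>

definition columns_independent :: "nat \<Rightarrow> (nat \<Rightarrow> 'a \<Rightarrow> real) \<Rightarrow> 'a set \<Rightarrow> bool" where
  "columns_independent r A B \<longleftrightarrow>
     (\<forall>x. (\<forall>i<r. (\<Sum>e\<in>B. x e * A i e) = 0) \<longrightarrow> (\<forall>e\<in>B. x e = 0))"

definition matrix_rank :: "nat \<Rightarrow> 'a set \<Rightarrow> (nat \<Rightarrow> 'a \<Rightarrow> real) \<Rightarrow> nat" where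
  "matrix_rank r E A = Max (card ` {B. B \<subseteq> E \<and> columns_independent r A B})"

definition bases :: "nat \<Rightarrow> 'a set \<Rightarrow> (nat \<Rightarrow> 'a \<Rightarrow> real) \<Rightarrow> 'a set set" where
  "bases r E A = {B. B \<subseteq> E \<and> columns_independent r A B \<and>
     (\<forall>B'. B \<subseteq> B' \<and> B' \<subseteq> E \<and> columns_independent r A B' \<longrightarrow> B' = B)}"

definition support_minimal :: "('a \<Rightarrow> real) set \<Rightarrow> ('a \<Rightarrow> real) set" where
  "support_minimal V = {v \<in> V. supp v \<noteq> {} \<and>
     (\<forall>w\<in>V. supp w \<noteq> {} \<and> supp w \<subseteq> supp v \<longrightarrow> supp w = supp v)}"

definition signed_circuits :: "nat \<Rightarrow> 'a set \<Rightarrow> (nat \<Rightarrow> 'a \<Rightarrow> real) \<Rightarrow> ('a \<Rightarrow> int) set" where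
  "signed_circuits r E A = sign_vec ` support_minimal (matrix_kernel r E A)"

definition signed_cocircuits :: "nat \<Rightarrow> 'a set \<Rightarrow> (nat \<Rightarrow> 'a \<Rightarrow> real) \<Rightarrow> ('a \<Rightarrow> int) set" where
  "signed_cocircuits r E A = sign_vec ` support_minimal (row_space r E A)"

definition circuits :: "nat \<Rightarrow> 'a set \<Rightarrow> (nat \<Rightarrow> 'a \<Rightarrow> real) \<Rightarrow> 'a set set" where
  "circuits r E A = supp ` signed_circuits r E A"

definition cocircuits :: "nat \<Rightarrow> 'a set \<Rightarrow> (nat \<Rightarrow> 'a \<Rightarrow> real) \<Rightarrow> 'a set set" where
  "cocircuits r E A = supp ` signed_cocircuits r E A"

text \<open>A signature of a set \<open>S\<close> of signed (co)circuits; its values on sets that are not supports of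
  members of \<open>S\<close> are irrelevant.\<close>

definition signature_of :: "('a \<Rightarrow> int) set \<Rightarrow> ('a set \<Rightarrow> 'a \<Rightarrow> int) \<Rightarrow> bool" where
  "signature_of S \<sigma> \<longleftrightarrow> (\<forall>C \<in> supp ` S. \<sigma> C \<in> S \<and> supp (\<sigma> C) = C)"

text \<open>Here \<open>V\<close> is the kernel (row space) and \<open>\<C>\<close> the set of (co)circuits. For a signed (co)circuit
  \<open>D\<close>, the open ray of \<open>V\<close> corresponding to \<open>D\<close> is \<open>{u \<in> V. sign_vec u = D}\<close>; \<open>v\<close> is any choice of
  representatives. Different choices differ by positive factors, which the coefficients \<open>a\<close> absorb,
  so quantifying over all choices is the same as fixing one.\<close>

definition acyclic_signature ::
    "('a \<Rightarrow> real) set \<Rightarrow> 'a set set \<Rightarrow> ('a set \<Rightarrow> 'a \<Rightarrow> int) \<Rightarrow> bool" where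
  "acyclic_signature V \<C> \<sigma> \<longleftrightarrow>
     (\<forall>v a. (\<forall>C\<in>\<C>. v C \<in> V \<and> sign_vec (v C) = \<sigma> C) \<and>
            (\<forall>C\<in>\<C>. (a C :: real) \<ge> 0) \<and>
            (\<forall>e. (\<Sum>C\<in>\<C>. a C * v C e) = 0)
        \<longrightarrow> (\<forall>C\<in>\<C>. a C = 0))"

definition fund_circuit ::
    "nat \<Rightarrow> 'a set \<Rightarrow> (nat \<Rightarrow> 'a \<Rightarrow> real) \<Rightarrow> 'a set \<Rightarrow> 'a \<Rightarrow> 'a set" where
  "fund_circuit r E A B e = (THE C. C \<in> circuits r E A \<and> C \<subseteq> B \<union> {e})"

definition fund_cocircuit ::
    "nat \<Rightarrow> 'a set \<Rightarrow> (nat \<Rightarrow> 'a \<Rightarrow> real) \<Rightarrow> 'a set \<Rightarrow> 'a \<Rightarrow> 'a set" where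
  "fund_cocircuit r E A B e = (THE C. C \<in> cocircuits r E A \<and> C \<subseteq> (E - B) \<union> {e})"

text \<open>Orientations are extensional functions (\<open>undefined\<close> outside \<open>E\<close>), so that two of them are equal
  iff they agree on \<open>E\<close>.\<close>

definition orientations :: "'a set \<Rightarrow> ('a \<Rightarrow> int) set" where
  "orientations E = E \<rightarrow>\<^sub>E {-1, 1}"

definition compatible :: "('a \<Rightarrow> int) \<Rightarrow> ('a \<Rightarrow> int) \<Rightarrow> bool" where
  "compatible \<O> C \<longleftrightarrow> (\<forall>e \<in> supp C. \<O> e = C e)"

definition compatible_orientations ::
    "nat \<Rightarrow> 'a set \<Rightarrow> (nat \<Rightarrow> 'a \<Rightarrow> real) \<Rightarrow> ('a set \<Rightarrow> 'a \<Rightarrow> int) \<Rightarrow> ('a set \<Rightarrow> 'a \<Rightarrow> int) \<Rightarrow> ('a \<Rightarrow> int) set"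
  where
  "compatible_orientations r E A \<sigma> \<sigma>' = {\<O> \<in> orientations E.
     (\<forall>C \<in> signed_circuits r E A. compatible \<O> C \<longrightarrow> C \<in> \<sigma> ` circuits r E A) \<and>
     (\<forall>C \<in> signed_cocircuits r E A. compatible \<O> C \<longrightarrow> C \<in> \<sigma>' ` cocircuits r E A)}"

definition beta_hat ::
    "nat \<Rightarrow> 'a set \<Rightarrow> (nat \<Rightarrow> 'a \<Rightarrow> real) \<Rightarrow> ('a set \<Rightarrow> 'a \<Rightarrow> int) \<Rightarrow> ('a set \<Rightarrow> 'a \<Rightarrow> int)
      \<Rightarrow> 'a set \<Rightarrow> 'a \<Rightarrow> int" where
  "beta_hat r E A \<sigma> \<sigma>' B = (\<lambda>e\<in>E.
     if e \<in> B then \<sigma>' (fund_cocircuit r E A B e) e else \<sigma> (fund_circuit r E A B e) e)"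

end

theory Submission
  imports Defs
begin

text \<open>
  Write \<open>V\<close> for the kernel and \<open>W\<close> for the row space; they are orthogonal complements, and every
  notion below is symmetric under exchanging \<open>V\<close> with \<open>W\<close> and a basis \<open>B\<close> with \<open>E - B\<close>. The bijection
  is linear programming duality for a nondegenerate pair of programs.

  By Farkas' lemma an acyclic signature of the circuits is induced by a vector \<open>w\<close>: the chosen ray
  on each circuit is the one on which \<open>\<langle>w, v\<rangle> > 0\<close>, and \<open>\<langle>w, v\<rangle> \<noteq> 0\<close> for every elementary (nonzero
  and support-minimal) \<open>v \<in> V\<close> (\<open>acyclic_signature_induced\<close>). Likewise \<open>w'\<close> induces
  the signature of the cocircuits. For a basis
  \<open>B\<close> there are a unique \<open>x \<in> w + W\<close> that vanishes on \<open>B\<close> and a unique \<open>y \<in> w' + V\<close> that vanishes off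
  \<open>B\<close>. If \<open>v \<in> V\<close> is supported in \<open>B \<union> {e}\<close>, then \<open>\<langle>w, v\<rangle> = \<langle>x, v\<rangle> = x e * v e\<close>; hence the orientation
  attached to \<open>B\<close> is the sign of \<open>x\<close> off \<open>B\<close> and the sign of \<open>y\<close> on \<open>B\<close>
  (\<open>signature_of_fundamental\<close>). So \<open>\<O>\<close> comes from \<open>B\<close> iff \<open>(x, y)\<close> is a strictly complementary pair
  whose signs are those of \<open>\<O>\<close>, which is the predicate \<open>oriented_by_basis\<close>.

  The image consists of compatible orientations: if \<open>v\<close> is elementary and conforms to \<open>\<O>\<close>, all
  summands of \<open>\<langle>w, v\<rangle> = \<langle>x, v\<rangle>\<close> are nonnegative, so \<open>\<langle>w, v\<rangle> > 0\<close>. Injectivity is uniqueness of the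
  optimum: for two bases with the same \<open>\<O>\<close> one has \<open>\<langle>x1 - x2, y1 - y2\<rangle> = 0\<close>, where the products \<open>x1 y1\<close> and
  \<open>x2 y2\<close> vanish and \<open>x1 y2\<close>, \<open>x2 y1\<close> are nonnegative, so all four products vanish
  and the supports, hence the bases, agree (\<open>oriented_by_basis_subset\<close>). For surjectivity,
  compatibility of \<open>\<O>\<close> says that both programs are
  feasible in the orthant of \<open>\<O>\<close>, so by duality they have solutions \<open>x\<close>, \<open>y\<close> in that orthant with
  \<open>\<langle>x, y\<rangle> \<le> 0\<close> (\<open>complementary_solutions\<close>). The zero set of \<open>x\<close> contains no circuit and that of \<open>y\<close> no
  cocircuit (\<open>independent_zero_set\<close>); as the two zero sets cover \<open>E\<close>, the zero set of \<open>x\<close> is the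
  required basis (\<open>oriented_by_basis_exists\<close>).
\<close>

section \<open>Farkas' lemma for subspaces\<close>

text \<open>A linear subspace of a coordinate space, except that the empty set is allowed.\<close>

definition subspace_like :: "('i \<Rightarrow> real) set \<Rightarrow> bool" where
  "subspace_like U \<longleftrightarrow> (\<forall>x\<in>U. \<forall>y\<in>U. \<forall>t. (\<lambda>i. x i + t * y i) \<in> U)"

lemma subspace_likeD: "subspace_like U \<Longrightarrow> x \<in> U \<Longrightarrow> y \<in> U \<Longrightarrow> (\<lambda>i. x i + t * y i) \<in> U"
  by (auto simp: subspace_like_def)

lemma subspace_like_coordinate_hyperplane:
  assumes "subspace_like U" shows "subspace_like {z \<in> U. z k = 0}"
  using assms by (auto simp: subspace_like_def)

text \<open>The coordinate \<open>j\<close> may itself lie in \<open>I\<close>: if no nonnegative member of \<open>U\<close> is positive at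
  \<open>j\<close>, then some nonnegative vector orthogonal to \<open>U\<close> is positive at \<open>j\<close>. The induction removes one
  coordinate \<open>k\<close> from \<open>I\<close>. If the hypothesis then fails, a witness \<open>x\<close> of the failure has \<open>x k < 0\<close>;
  the induction hypothesis for the hyperplane \<open>z k = 0\<close> gives multipliers for \<open>I\<close>, and the multiplier
  of \<open>k\<close> is determined by \<open>x\<close>, since \<open>U\<close> is spanned by the hyperplane and \<open>x\<close>.\<close>

lemma farkas_subspace:
  assumes "finite I" "subspace_like U" "\<And>z. z \<in> U \<Longrightarrow> (\<forall>i\<in>I. z i \<ge> 0) \<Longrightarrow> z j \<le> 0"
  shows "\<exists>l. (\<forall>i\<in>I. l i \<ge> 0) \<and> (\<forall>z\<in>U. z j + (\<Sum>i\<in>I. l i * z i) = 0)"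
  using assms
proof (induction I arbitrary: U rule: finite_induct)
  case empty
  \<comment> \<open>\<open>z + (-2) * z = - z\<close>\<close>
  have "z j = 0" if "z \<in> U" for z
    using empty(2)[OF that] empty(2)[OF subspace_likeD[OF empty(1) that that, of "-2"]] by simp
  then show ?case by simp
next
  case (insert k I)
  show ?case
  proof (cases "\<forall>z\<in>U. (\<forall>i\<in>I. z i \<ge> 0) \<longrightarrow> z j \<le> 0")
    case True
    then obtain l where l: "\<forall>i\<in>I. l i \<ge> 0" "\<forall>z\<in>U. z j + (\<Sum>i\<in>I. l i * z i) = 0"
      using insert.IH[OF insert.prems(1)] by blast
    have "(\<Sum>i\<in>insert k I. (l(k := 0)) i * z i) = (\<Sum>i\<in>I. l i * z i)" for z
      using insert.hyps by (auto intro!: sum.cong)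
    with l show ?thesis by (intro exI[of _ "l(k := 0)"]) auto
  next
    case False
    then obtain x where x: "x \<in> U" "\<forall>i\<in>I. x i \<ge> 0" "x j > 0" by force
    have xk: "x k < 0"
      using insert.prems(2)[OF x(1)] x by force
    have "\<exists>l. (\<forall>i\<in>I. l i \<ge> 0) \<and> (\<forall>z\<in>{z\<in>U. z k = 0}. z j + (\<Sum>i\<in>I. l i * z i) = 0)"
      by (rule insert.IH[OF subspace_like_coordinate_hyperplane[OF insert.prems(1)]])
        (use insert.prems(2) in auto)
    then obtain l where l: "\<forall>i\<in>I. l i \<ge> 0"
      "\<And>z. z \<in> U \<Longrightarrow> z k = 0 \<Longrightarrow> z j + (\<Sum>i\<in>I. l i * z i) = 0" by auto
    define c where "c = - (x j + (\<Sum>i\<in>I. l i * x i)) / x k"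
    have "c \<ge> 0"
    proof -
      have "(\<Sum>i\<in>I. l i * x i) \<ge> 0" using l(1) x(2) by (intro sum_nonneg) auto
      then show ?thesis using x(3) xk by (auto simp: c_def divide_simps)
    qed
    have "z j + (\<Sum>i\<in>insert k I. (l(k := c)) i * z i) = 0" if z: "z \<in> U" for z
    proof -
      have s: "(\<Sum>i\<in>insert k I. (l(k := c)) i * z i) = c * z k + (\<Sum>i\<in>I. l i * z i)"
        using insert.hyps by (auto intro!: sum.cong)
      define t where "t = - z k / x k"
      have "(z j + t * x j) + (\<Sum>i\<in>I. l i * (z i + t * x i)) = 0"
        using l(2)[OF subspace_likeD[OF insert.prems(1) z x(1), of t]] xk by (simp add: t_def)
      then have "z j + (\<Sum>i\<in>I. l i * z i) + t * (x j + (\<Sum>i\<in>I. l i * x i)) = 0"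
        by (simp add: algebra_simps sum.distrib sum_distrib_left)
      moreover have "t * (x j + (\<Sum>i\<in>I. l i * x i)) = c * z k"
        using xk by (simp add: t_def c_def field_simps)
      ultimately show ?thesis using s by simp
    qed
    then show ?thesis using l(1) \<open>c \<ge> 0\<close> insert.hyps
      by (intro exI[of _ "l(k := c)"]) auto
  qed
qed

text \<open>The version of Farkas' lemma with equations in place of inequalities, by the same
  elimination.\<close>

lemma coordinate_in_span:
  assumes "finite I" "subspace_like U" "\<And>z. z \<in> U \<Longrightarrow> (\<forall>i\<in>I. z i = 0) \<Longrightarrow> z j = 0"
  shows "\<exists>l. \<forall>z\<in>U. z j = (\<Sum>i\<in>I. l i * z i)"
  using assms
proof (induction I arbitrary: U rule: finite_induct)
  case empty
  then show ?case by simp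
next
  case (insert k I)
  have "\<exists>l. \<forall>z\<in>{z\<in>U. z k = 0}. z j = (\<Sum>i\<in>I. l i * z i)"
    by (rule insert.IH[OF subspace_like_coordinate_hyperplane[OF insert.prems(1)]])
      (use insert.prems(2) in auto)
  then obtain l where l: "\<And>z. z \<in> U \<Longrightarrow> z k = 0 \<Longrightarrow> z j = (\<Sum>i\<in>I. l i * z i)" by auto
  have ins: "(\<Sum>i\<in>insert k I. (l(k := c)) i * z i) = c * z k + (\<Sum>i\<in>I. l i * z i)" for c z
    using insert.hyps by (auto intro!: sum.cong)
  show ?case
  proof (cases "\<exists>x\<in>U. x k \<noteq> 0")
    case False
    then show ?thesis using l ins[of 0] by (intro exI[of _ "l(k := 0)"]) auto
  next
    case True
    then obtain x where x: "x \<in> U" "x k \<noteq> 0" by blast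
    define c where "c = (x j - (\<Sum>i\<in>I. l i * x i)) / x k"
    have "z j = c * z k + (\<Sum>i\<in>I. l i * z i)" if z: "z \<in> U" for z
    proof -
      define t where "t = - z k / x k"
      have "z j + t * x j = (\<Sum>i\<in>I. l i * (z i + t * x i))"
        using l[OF subspace_likeD[OF insert.prems(1) z x(1), of t]] x by (simp add: t_def)
      then have "z j = (\<Sum>i\<in>I. l i * z i) - t * (x j - (\<Sum>i\<in>I. l i * x i))"
        by (simp add: algebra_simps sum.distrib sum_distrib_left)
      moreover have "t * (x j - (\<Sum>i\<in>I. l i * x i)) = - (c * z k)"
        by (simp add: t_def c_def)
      ultimately show ?thesis by simp
    qed
    then show ?thesis using ins[of c] by (intro exI[of _ "l(k := c)"]) auto
  qed
qed

section \<open>Orthogonal pairs of subspaces\<close>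

definition dot :: "'a set \<Rightarrow> ('a \<Rightarrow> real) \<Rightarrow> ('a \<Rightarrow> real) \<Rightarrow> real" where
  "dot E x y = (\<Sum>e\<in>E. x e * y e)"

lemma dot_commute: "dot E x y = dot E y x"
  by (simp add: dot_def mult.commute)

lemma dot_add_scale_left: "dot E (\<lambda>e. x e + t * y e) z = dot E x z + t * dot E y z"
  by (simp add: dot_def algebra_simps sum.distrib sum_distrib_left)

lemma dot_add_scale_right: "dot E z (\<lambda>e. x e + t * y e) = dot E z x + t * dot E z y"
  using dot_add_scale_left[of E x t y z] by (simp add: dot_commute)

lemma dot_diff_left: "dot E (\<lambda>e. x e - y e) z = dot E x z - dot E y z"
  by (simp add: dot_def algebra_simps sum_subtractf)

lemma dot_indicator:
  assumes "finite E" "e \<in> E"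
  shows "dot E x (\<lambda>f. if f = e then 1 else 0) = x e"
  using assms by (simp add: dot_def if_distrib[of "\<lambda>t. _ * t"] cong: if_cong)

lemma dot_single:
  assumes "finite E" "e \<in> E" "\<And>f. f \<in> E \<Longrightarrow> f \<noteq> e \<Longrightarrow> x f * y f = 0"
  shows "dot E x y = x e * y e"
  proof -
  have "(\<Sum>f\<in>E - {e}. x f * y f) = 0" using assms(3) by (intro sum.neutral) blast
  then show ?thesis unfolding dot_def by (subst sum.remove[OF assms(1,2)]) simp
qed

lemma supp_sign_vec [simp]: "supp (sign_vec v) = supp v"
  by (auto simp: supp_def sign_vec_def)

lemma sign_vec_eq_iff_mult_pos:
  "v e \<noteq> 0 \<Longrightarrow> sign_vec v e = sign_vec x e \<longleftrightarrow> v e * x e > 0"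
  by (auto simp: sign_vec_def zero_less_mult_iff)

lemma sign_vec_eq_orientation_iff:
  "oe \<in> {-1, 1} \<Longrightarrow> sign_vec v e = oe \<longleftrightarrow> of_int oe * v e > 0"
  by (auto simp: sign_vec_def)

abbreviation circuits_of :: "('a \<Rightarrow> real) set \<Rightarrow> 'a set set" where
  "circuits_of V \<equiv> supp ` sign_vec ` support_minimal V"

text \<open>The common form of fundamental circuits (\<open>V\<close> the kernel, \<open>B\<close> a basis) and fundamental
  cocircuits (\<open>V\<close> the row space, \<open>B\<close> the complement of a basis).\<close>

definition fundamental :: "('a \<Rightarrow> real) set \<Rightarrow> 'a set \<Rightarrow> 'a \<Rightarrow> 'a set" where
  "fundamental V B e = (THE C. C \<in> circuits_of V \<and> C \<subseteq> B \<union> {e})"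

datatype 'a lp_coordinate = Primal 'a | Dual 'a | Gap | Scale

text \<open>The hypotheses are symmetric in \<open>V\<close> and \<open>W\<close>, so every fact about \<open>V\<close>, \<open>B\<close> and circuits is
  also one about \<open>W\<close>, \<open>E - B\<close> and cocircuits.\<close>

locale orthogonal_pair =
  fixes E :: "'a set" and V W :: "('a \<Rightarrow> real) set"
  assumes finite_E: "finite E"
    and V_iff: "v \<in> V \<longleftrightarrow> supp v \<subseteq> E \<and> (\<forall>u\<in>W. dot E v u = 0)"
    and W_iff: "u \<in> W \<longleftrightarrow> supp u \<subseteq> E \<and> (\<forall>v\<in>V. dot E u v = 0)"
begin

lemma dual: "orthogonal_pair E W V"
  by unfold_locales (use finite_E V_iff W_iff in blast)+

lemma V_add_scale: "x \<in> V \<Longrightarrow> y \<in> V \<Longrightarrow> (\<lambda>e. x e + t * y e) \<in> V"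
  unfolding V_iff by (fastforce simp: dot_add_scale_left supp_def)

lemma subspace_like_V: "subspace_like V"
  using V_add_scale by (auto simp: subspace_like_def)

lemma V_scale: "x \<in> V \<Longrightarrow> (\<lambda>e. t * x e) \<in> V"
  using V_add_scale[of x x "t - 1"] by (simp add: algebra_simps)

lemma V_diff: "x \<in> V \<Longrightarrow> y \<in> V \<Longrightarrow> (\<lambda>e. x e - y e) \<in> V"
  using V_add_scale[of x y "-1"] by simp

lemma zero_in_V: "(\<lambda>e. 0) \<in> V"
  unfolding V_iff by (auto simp: dot_def supp_def) 

lemma supp_V: "v \<in> V \<Longrightarrow> supp v \<subseteq> E"
  by (simp add: V_iff)

lemma orthogonal: "v \<in> V \<Longrightarrow> u \<in> W \<Longrightarrow> dot E v u = 0"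
  by (simp add: V_iff)

lemma dot_congruent:
  assumes "(\<lambda>e. x e - w e) \<in> W" "v \<in> V"
  shows "dot E w v = dot E x v"
  using orthogonal[OF assms(2,1)] by (simp add: dot_diff_left dot_commute[of E v])

lemma finite_circuits_of: "finite (circuits_of V)"
proof (rule finite_subset)
  show "circuits_of V \<subseteq> Pow E"
    using supp_V by (fastforce simp: support_minimal_def)
qed (use finite_E in simp)

text \<open>Subtracting the multiple that cancels one coordinate leaves a member of \<open>V\<close> with strictly
  smaller support, which minimality forces to be zero.\<close>

lemma support_minimal_proportional:
  assumes "v \<in> support_minimal V" "v' \<in> V" "supp v' \<subseteq> supp v" "supp v' \<noteq> {}"
  shows "\<exists>k. k \<noteq> 0 \<and> v' = (\<lambda>e. k * v e)"
proof -
  have v: "v \<in> V" using assms by (simp add: support_minimal_def)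
  obtain e where e: "v' e \<noteq> 0" using assms by (auto simp: supp_def)
  then have ve: "v e \<noteq> 0" using assms by (auto simp: supp_def)
  define k where "k = v' e / v e"
  let ?d = "\<lambda>f. v' f + (- k) * v f"
  have "?d \<in> V" by (intro V_add_scale assms v)
  moreover have "supp ?d \<subseteq> supp v" "e \<notin> supp ?d"
    using assms(3) ve by (auto simp: supp_def k_def)
  moreover have "e \<in> supp v" using ve by (simp add: supp_def)
  ultimately have "supp ?d = {}" using assms(1) unfolding support_minimal_def by blast
  then have "v' = (\<lambda>e. k * v e)" by (auto simp: supp_def fun_eq_iff)
  moreover have "k \<noteq> 0" using e ve by (simp add: k_def)
  ultimately show ?thesis by blast
qed

lemma support_minimal_below:
  assumes "v \<in> V" "supp v \<noteq> {}"
  shows "\<exists>z\<in>support_minimal V. supp z \<subseteq> supp v"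
  using assms
proof (induction "card (supp v)" arbitrary: v rule: less_induct)
  case less
  show ?case
  proof (cases "v \<in> support_minimal V")
    case False
    then obtain z where z: "z \<in> V" "supp z \<noteq> {}" "supp z \<subset> supp v"
      using less.prems by (auto simp: support_minimal_def)
    have "card (supp z) < card (supp v)"
      using z(3) supp_V[OF less.prems(1)] finite_E by (meson finite_subset psubset_card_mono)
    then show ?thesis using less.hyps[OF _ z(1,2)] z(3) by blast
  qed auto
qed

subsection \<open>Bases and their basic solutions\<close>

text \<open>Independence of \<open>B\<close>, and spanning by \<open>B\<close> in the form of independence of \<open>E - B\<close> in the dual.\<close>

definition basis :: "'a set \<Rightarrow> bool" where
  "basis B \<longleftrightarrow> B \<subseteq> E \<and> (\<forall>v\<in>V. supp v \<subseteq> B \<longrightarrow> supp v = {}) \<and>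
     (\<forall>u\<in>W. supp u \<subseteq> E - B \<longrightarrow> supp u = {})"

lemma basis_dual: "basis B \<Longrightarrow> orthogonal_pair.basis E W V (E - B)"
  unfolding orthogonal_pair.basis_def[OF dual] basis_def by (auto simp: double_diff)

text \<open>A member of \<open>W\<close> that vanishes on \<open>B\<close> is zero, so on \<open>W\<close> the coordinate \<open>e\<close> is a linear
  combination of the coordinates in \<open>B\<close>; this linear relation is orthogonal to \<open>W\<close>, hence a vector
  of \<open>V\<close>.\<close>

lemma fundamental_vector:
  assumes "basis B" "e \<in> E - B"
  shows "\<exists>v\<in>V. supp v \<subseteq> B \<union> {e} \<and> v e = 1"
proof -
  have B: "B \<subseteq> E" "finite B" using assms finite_E by (auto simp: basis_def intro: finite_subset)
  have "\<exists>l. \<forall>z\<in>W. z e = (\<Sum>i\<in>B. l i * z i)"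
  proof (rule coordinate_in_span[OF B(2)])
    show "subspace_like W" by (rule orthogonal_pair.subspace_like_V[OF dual])
    fix z assume z: "z \<in> W" "\<forall>i\<in>B. z i = 0"
    then have "supp z \<subseteq> E - B"
      using orthogonal_pair.supp_V[OF dual z(1)] by (auto simp: supp_def)
    then have "supp z = {}" using assms(1) z(1) unfolding basis_def by blast
    then show "z e = 0" by (simp add: supp_def)
  qed
  then obtain l where l: "\<And>z. z \<in> W \<Longrightarrow> z e = (\<Sum>i\<in>B. l i * z i)" by blast
  define v where "v = (\<lambda>f. if f = e then 1 else if f \<in> B then - l f else 0)"
  have "dot E v u = 0" if "u \<in> W" for u
  proof -
    have "dot E v u = (\<Sum>f\<in>insert e B. v f * u f)"
      unfolding dot_def using B assms finite_E by (intro sum.mono_neutral_right) (auto simp: v_def)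
    also have "\<dots> = u e + (\<Sum>f\<in>B. - l f * u f)"
      using assms B by (simp add: v_def) (auto intro!: sum.cong)
    also have "\<dots> = 0" using l[OF that] by (simp add: sum_negf)
    finally show ?thesis .
  qed
  moreover have "supp v \<subseteq> B \<union> {e}" "v e = 1" by (auto simp: v_def supp_def)
  ultimately show ?thesis using V_iff B assms by (intro bexI[of _ v]) auto
qed

lemma fundamental_circuit:
  assumes "basis B" "e \<in> E - B"
  shows "fundamental V B e \<in> circuits_of V" "fundamental V B e \<subseteq> B \<union> {e}"
proof -
  obtain v where v: "v \<in> V" "supp v \<subseteq> B \<union> {e}" "v e = 1"
    using fundamental_vector[OF assms] by blast
  have proportional: "supp z = supp v" if z: "z \<in> V" "supp z \<noteq> {}" "supp z \<subseteq> B \<union> {e}" for z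
  proof -
    have ze: "z e \<noteq> 0" using z assms(1) by (auto simp: basis_def supp_def)
    let ?d = "\<lambda>f. z f + (- z e) * v f"
    have "?d \<in> V" by (intro V_add_scale z v)
    moreover have "supp ?d \<subseteq> B"
      proof
      fix f assume f: "f \<in> supp ?d"
      then have "f \<noteq> e" using v(3) by (auto simp: supp_def)
      moreover have "f \<in> supp z \<union> supp v" using f by (auto simp: supp_def)
      ultimately show "f \<in> B" using z(3) v(2) by blast
    qed
    ultimately have "supp ?d = {}" using assms(1) unfolding basis_def by blast
    then have "z f + (- z e) * v f = 0" for f unfolding supp_def by blast
    then have "z f = 0 \<longleftrightarrow> v f = 0" for f
      using ze by (metis add.right_neutral mult_eq_0_iff neg_equal_0_iff_equal add_0)
    then show ?thesis by (simp add: supp_def)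
  qed
  have nz: "supp v \<noteq> {}" using v(3) by (auto simp: supp_def intro!: exI[of _ e])
  have "v \<in> support_minimal V"
    unfolding support_minimal_def using v(1,2) nz proportional by blast
  then have circuit: "supp v \<in> circuits_of V" by (auto simp: image_image)
  have unique: "C = supp v" if C: "C \<in> circuits_of V" "C \<subseteq> B \<union> {e}" for C
  proof -
    obtain z where z: "z \<in> support_minimal V" "C = supp z"
      using C(1) by auto
    then have "z \<in> V" "supp z \<noteq> {}" by (simp_all add: support_minimal_def)
    then show ?thesis using proportional C(2) z(2) by simp
  qed
  have "fundamental V B e = supp v"
    unfolding fundamental_def
  proof (rule the_equality)
    show "supp v \<in> circuits_of V \<and> supp v \<subseteq> B \<union> {e}" using circuit v(2) by (rule conjI)
    show "C = supp v" if "C \<in> circuits_of V \<and> C \<subseteq> B \<union> {e}" for C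
      using unique that by blast
  qed
  then show "fundamental V B e \<in> circuits_of V" "fundamental V B e \<subseteq> B \<union> {e}"
    using circuit v(2) by (simp_all only:)
qed

text \<open>The value \<open>x e\<close> off \<open>B\<close> is forced to be the product of \<open>w\<close> with the fundamental vector of \<open>e\<close>.
  It works because the fundamental vectors span \<open>V\<close>: subtracting from \<open>v\<close> the combination with the
  same coordinates off \<open>B\<close> leaves a vector supported in \<open>B\<close>, which is zero.\<close>

lemma basis_representative:
  assumes "basis B"
  shows "\<exists>x. (\<lambda>e. x e - w e) \<in> W \<and> (\<forall>e\<in>B. x e = 0)"
proof -
  obtain \<phi> where \<phi>: "\<And>e. e \<in> E - B \<Longrightarrow> \<phi> e \<in> V \<and> supp (\<phi> e) \<subseteq> B \<union> {e} \<and> \<phi> e e = 1"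
    using fundamental_vector[OF assms] by metis
  define x where "x = (\<lambda>e. if e \<notin> E then w e else if e \<in> B then 0 else dot E w (\<phi> e))"
  have B: "B \<subseteq> E" using assms by (simp add: basis_def)
  have "dot E (\<lambda>e. x e - w e) v = 0" if v: "v \<in> V" for v
  proof -
    have sum_V: "(\<lambda>e. v e - (\<Sum>f\<in>F. v f * \<phi> f e)) \<in> V" if "F \<subseteq> E - B" for F
      using finite_subset[OF that] finite_E that
    proof (induction F rule: infinite_finite_induct)
      case (insert g F)
      then have "(\<lambda>e. (v e - (\<Sum>f\<in>F. v f * \<phi> f e)) + (- v g) * \<phi> g e) \<in> V"
        using \<phi> by (intro V_add_scale) auto
      then show ?case using insert.hyps by (simp add: algebra_simps)
    qed (use v in auto)
    let ?d = "\<lambda>e. v e - (\<Sum>f\<in>E - B. v f * \<phi> f e)"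
    have "?d e = 0" if "e \<notin> B" for e
    proof (cases "e \<in> E")
      case True
      have "\<phi> f e = 0" if "f \<in> E - B - {e}" for f
        using \<phi>[of f] that \<open>e \<notin> B\<close> by (auto simp: supp_def)
      then have "(\<Sum>f\<in>E - B. v f * \<phi> f e) = v e * \<phi> e e"
        using True that finite_E by (subst sum.remove[of _ e]) auto
      then show ?thesis using \<phi>[of e] True that by simp
    next
      case False
      then show ?thesis using supp_V[OF sum_V[of "E - B"]] by (auto simp: supp_def)
    qed
    then have "supp ?d \<subseteq> B" unfolding supp_def by blast
    then have "supp ?d = {}"
      using sum_V[of "E - B"] assms unfolding basis_def by blast
    then have "?d e = 0" for e unfolding supp_def by blast
    then have "v = (\<lambda>e. \<Sum>f\<in>E - B. v f * \<phi> f e)" by (intro ext) (rule eq_iff_diff_eq_0[THEN iffD2])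
    then have "dot E w v = dot E w (\<lambda>e. \<Sum>f\<in>E - B. v f * \<phi> f e)" by (rule arg_cong)
    also have "\<dots> = (\<Sum>f\<in>E - B. dot E w (\<phi> f) * v f)"
      unfolding dot_def sum_distrib_left sum_distrib_right
      by (subst sum.swap) (simp add: mult_ac)
    also have "\<dots> = dot E x v"
      unfolding dot_def[of E x] using finite_E
      by (intro sum.mono_neutral_cong_left) (auto simp: x_def)
    finally show ?thesis by (simp add: dot_diff_left)
  qed
  moreover have "supp (\<lambda>e. x e - w e) \<subseteq> E" by (auto simp: supp_def x_def)
  ultimately show ?thesis using B by (intro exI[of _ x]) (auto simp: W_iff x_def)
qed

subsection \<open>Acyclic signatures are induced by vectors\<close>

definition inducing :: "('a set \<Rightarrow> 'a \<Rightarrow> int) \<Rightarrow> ('a \<Rightarrow> real) \<Rightarrow> bool" where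
  "inducing \<sigma> w \<longleftrightarrow> (\<forall>v\<in>support_minimal V. dot E w v \<noteq> 0 \<and>
     (dot E w v > 0 \<longleftrightarrow> sign_vec v = \<sigma> (supp v)))"

text \<open>Gordan's alternative. If no \<open>w\<close> were nonnegative on all chosen rays and positive on the one of
  \<open>D\<close>, Farkas' lemma would give a vanishing nonnegative combination of the rays with a positive
  coefficient at \<open>D\<close>, against acyclicity. The sum over \<open>D\<close> of such \<open>w\<close> is positive on every chosen
  ray; on an opposite ray it is then negative, because elementary vectors with equal supports are
  proportional.\<close>

lemma acyclic_signature_induced:
  assumes sig: "signature_of (sign_vec ` support_minimal V) \<sigma>"
    and acyclic: "acyclic_signature V (circuits_of V) \<sigma>"
  shows "\<exists>w. inducing \<sigma> w"
proof -
  let ?C = "circuits_of V"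
  have "\<exists>v. v \<in> support_minimal V \<and> sign_vec v = \<sigma> C \<and> supp v = C" if "C \<in> ?C" for C
    using sig that unfolding signature_of_def by (metis imageE supp_sign_vec)
  then obtain v where v: "\<And>C. C \<in> ?C \<Longrightarrow> v C \<in> support_minimal V \<and> sign_vec (v C) = \<sigma> C \<and> supp (v C) = C"
    by metis
  have vV: "v C \<in> V" if "C \<in> ?C" for C using v[OF that] by (simp add: support_minimal_def)
  have "\<exists>w. (\<forall>C\<in>?C. dot E w (v C) \<ge> 0) \<and> dot E w (v D) > 0" if D: "D \<in> ?C" for D
  proof (rule ccontr)
    assume no: "\<not> ?thesis"
    let ?U = "range (\<lambda>w C. dot E w (v C))"
    have "\<exists>l. (\<forall>C\<in>?C. l C \<ge> 0) \<and> (\<forall>z\<in>?U. z D + (\<Sum>C\<in>?C. l C * z C) = 0)"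
    proof (rule farkas_subspace[OF finite_circuits_of])
      show "subspace_like ?U"
        unfolding subspace_like_def
        by (auto simp: dot_add_scale_left[symmetric])
      show "z D \<le> 0" if "z \<in> ?U" "\<forall>C\<in>?C. z C \<ge> 0" for z
        using that no by force
    qed
    then obtain l where l: "\<forall>C\<in>?C. l C \<ge> 0"
      "\<And>w. dot E w (v D) + (\<Sum>C\<in>?C. l C * dot E w (v C)) = 0" by auto
    \<comment> \<open>The isolated term \<open>v D\<close> of the relation adds 1 to the coefficient of \<open>D\<close>, so \<open>a D > 0\<close>.\<close>
    define a where "a = l(D := l D + 1)"
    have a: "(\<Sum>C\<in>?C. a C * z C) = z D + (\<Sum>C\<in>?C. l C * z C)" for z :: "'a set \<Rightarrow> real"
      using D finite_circuits_of by (simp add: a_def sum.remove[of ?C D] algebra_simps)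
    have "(\<Sum>C\<in>?C. a C * v C e) = 0" for e
    proof (cases "e \<in> E")
      case True
      show ?thesis
        using l(2)[of "\<lambda>f. if f = e then 1 else 0"] True finite_E
        by (simp add: a[of "\<lambda>C. v C e"] dot_commute[of E "\<lambda>f. if f = e then 1 else 0"] dot_indicator)
    next
      case False
      then have "v C e = 0" if "C \<in> ?C" for C
        using supp_V[OF vV[OF that]] by (auto simp: supp_def)
      then show ?thesis by simp
    qed
    moreover have "\<forall>C\<in>?C. a C \<ge> 0" using l(1) by (auto simp: a_def)
    ultimately have "a D = 0"
      using acyclic v vV D unfolding acyclic_signature_def by blast
    then show False using l(1) D by (fastforce simp: a_def)
  qed
  then obtain \<omega> where \<omega>: "\<And>D. D \<in> ?C \<Longrightarrow> (\<forall>C\<in>?C. dot E (\<omega> D) (v C) \<ge> 0) \<and> dot E (\<omega> D) (v D) > 0"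
    by metis
  define w where "w = (\<lambda>e. \<Sum>D\<in>?C. \<omega> D e)"
  have w: "dot E w (v C) > 0" if C: "C \<in> ?C" for C
  proof -
    have "dot E w (v C) = (\<Sum>D\<in>?C. dot E (\<omega> D) (v C))"
      unfolding dot_def w_def sum_distrib_right by (rule sum.swap)
    also have "\<dots> > 0" using \<omega> C by (intro sum_pos2[OF finite_circuits_of C]) blast+
    finally show ?thesis .
  qed
  have "dot E w u \<noteq> 0 \<and> (dot E w u > 0 \<longleftrightarrow> sign_vec u = \<sigma> (supp u))"
    if u: "u \<in> support_minimal V" for u
  proof -
    have C: "supp u \<in> ?C" using u by (auto simp: image_image)
    obtain k where k: "k \<noteq> 0" "u = (\<lambda>e. k * v (supp u) e)"
      using support_minimal_proportional[of "v (supp u)" u] v[OF C] u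
      by (auto simp: support_minimal_def)
    have d: "dot E w u = k * dot E w (v (supp u))"
      by (subst k(2)) (simp add: dot_def sum_distrib_left mult_ac)
    obtain e where e: "v (supp u) e \<noteq> 0"
      using u k(2) by (force simp: support_minimal_def supp_def)
    have "k > 0 \<longleftrightarrow> sign_vec u = sign_vec (v (supp u))"
    proof
      assume "k > 0"
      then show "sign_vec u = sign_vec (v (supp u))"
        by (subst k(2)) (auto simp: sign_vec_def fun_eq_iff zero_less_mult_iff mult_less_0_iff)
    next
      assume "sign_vec u = sign_vec (v (supp u))"
      then have "sign_vec (v (supp u)) e = sign_vec u e" by simp
      then have "v (supp u) e * u e > 0" using e by (simp add: sign_vec_eq_iff_mult_pos)
      then have "k * (v (supp u) e)\<^sup>2 > 0"
        using k(2) by (metis mult.assoc mult.commute power2_eq_square)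
      then show "k > 0" using e by (simp add: zero_less_mult_iff)
    qed
    then show ?thesis using d w[OF C] k(1) v[OF C] by (auto simp: zero_less_mult_iff)
  qed
  then show ?thesis unfolding inducing_def by blast
qed

text \<open>A vector \<open>v\<close> on the chosen ray of the fundamental circuit has \<open>dot E w v > 0\<close>; its support
  meets that of \<open>x\<close> only in \<open>e\<close>, so this product is \<open>x e * v e\<close>.\<close>

lemma signature_of_fundamental:
  assumes sig: "signature_of (sign_vec ` support_minimal V) \<sigma>" and w: "inducing \<sigma> w"
    and B: "basis B" and x: "(\<lambda>e. x e - w e) \<in> W" "\<And>e. e \<in> B \<Longrightarrow> x e = 0" and e: "e \<in> E - B"
  shows "x e \<noteq> 0" "\<sigma> (fundamental V B e) e = sign_vec x e"
proof -
  let ?C = "fundamental V B e"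
  note C = fundamental_circuit[OF B e]
  obtain v where v: "v \<in> support_minimal V" "sign_vec v = \<sigma> ?C" "supp v = ?C"
    using sig C(1) unfolding signature_of_def by (metis imageE supp_sign_vec)
  have "dot E w v > 0" using w v unfolding inducing_def by auto
  also have "dot E w v = dot E x v"
    using dot_congruent[OF x(1)] v(1) by (simp add: support_minimal_def)
  also have "\<dots> = x e * v e"
  proof (rule dot_single[OF finite_E])
    show "x f * v f = 0" if "f \<in> E" "f \<noteq> e" for f
      using x(2)[of f] v(3) C(2) that by (cases "f \<in> B") (auto simp: supp_def)
  qed (use e in auto)
  finally have "x e * v e > 0" .
  then show "x e \<noteq> 0" by auto
  then show "\<sigma> ?C e = sign_vec x e"
    using sign_vec_eq_iff_mult_pos[of x e v] \<open>x e * v e > 0\<close> v(2) by simp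
qed

lemma compatible_circuits_iff:
  assumes sig: "signature_of (sign_vec ` support_minimal V) \<sigma>" and w: "inducing \<sigma> w"
  shows "(\<forall>C\<in>sign_vec ` support_minimal V. compatible \<O> C \<longrightarrow> C \<in> \<sigma> ` circuits_of V) \<longleftrightarrow>
    (\<forall>v\<in>support_minimal V. compatible \<O> (sign_vec v) \<longrightarrow> dot E w v > 0)"
proof -
  have "sign_vec v \<in> \<sigma> ` circuits_of V \<longleftrightarrow> dot E w v > 0" if v: "v \<in> support_minimal V" for v
  proof -
    have C: "supp v \<in> circuits_of V" using v by (auto simp: image_image)
    have "sign_vec v \<in> \<sigma> ` circuits_of V \<longleftrightarrow> sign_vec v = \<sigma> (supp v)"
    proof
      assume "sign_vec v \<in> \<sigma> ` circuits_of V"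
      then obtain D where D: "D \<in> circuits_of V" "sign_vec v = \<sigma> D" by auto
      have "supp (\<sigma> D) = D" using bspec[OF sig[unfolded signature_of_def] D(1)] ..
      then have "D = supp v" by (simp flip: D(2))
      then show "sign_vec v = \<sigma> (supp v)" using D(2) by simp
    qed (use C in auto)
    then show ?thesis using w v by (auto simp: inducing_def)
  qed
  then show ?thesis by auto
qed

text \<open>The summands of \<open>dot E w v = dot E x v\<close> are nonnegative because \<open>x\<close> and \<open>v\<close> both conform to
  \<open>\<O>\<close>, and the sum is nonzero because \<open>w\<close> is nondegenerate.\<close>

lemma compatible_of_representative:
  assumes w: "inducing \<sigma> w" and x: "(\<lambda>e. x e - w e) \<in> W"
    and xO: "\<And>e. e \<in> E \<Longrightarrow> x e \<noteq> 0 \<Longrightarrow> \<O> e = sign_vec x e"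
    and v: "v \<in> support_minimal V" "compatible \<O> (sign_vec v)"
  shows "dot E w v > 0"
proof -
  have "x e * v e \<ge> 0" if "e \<in> E" for e
  proof (cases "x e = 0 \<or> v e = 0")
    case False
    then have "sign_vec x e = sign_vec v e"
      using v(2) xO[OF that] unfolding compatible_def supp_sign_vec by (simp add: supp_def)
    then show ?thesis using False sign_vec_eq_iff_mult_pos[of x e v] by simp
  qed auto
  then have "dot E x v \<ge> 0" unfolding dot_def by (intro sum_nonneg) auto
  then have "dot E w v \<ge> 0"
    using dot_congruent[OF x] v(1) by (simp add: support_minimal_def)
  moreover have "dot E w v \<noteq> 0" using w v(1) by (simp add: inducing_def)
  ultimately show ?thesis by simp
qed

subsection \<open>Conformal vectors\<close>

text \<open>The ratio test: \<open>t\<close> is the largest step along \<open>- z\<close> that stays in the closed orthant of \<open>s\<close>,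
  and the coordinate that attains it drops out of the support.\<close>

lemma reduce_support:
  assumes v: "v \<in> V" "\<And>e. e \<in> E \<Longrightarrow> s e * v e \<ge> 0"
    and z: "z \<in> V" "supp z \<subseteq> supp v" "e0 \<in> E" "s e0 * z e0 > 0"
  shows "\<exists>t\<ge>0. (\<forall>e\<in>E. s e * (v e - t * z e) \<ge> 0) \<and> supp (\<lambda>e. v e - t * z e) \<subset> supp v"
proof -
  let ?P = "{e\<in>E. s e * z e > 0}"
  let ?q = "\<lambda>e. (s e * v e) / (s e * z e)"
  have P: "finite ?P" "?P \<noteq> {}" using finite_E z by auto
  define t where "t = Min (?q ` ?P)"
  have "t \<in> ?q ` ?P" using P unfolding t_def by (intro Min_in) auto
  then obtain p where p: "p \<in> ?P" "t = ?q p" by blast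
  have le: "t \<le> ?q e" if "e \<in> ?P" for e using P that unfolding t_def by (intro Min_le) auto
  have "s p * v p \<ge> 0" "s p * z p > 0" using p(1) v(2) by auto
  then have t: "t \<ge> 0" unfolding p(2) by (rule divide_nonneg_pos)
  have "s e * (v e - t * z e) \<ge> 0" if e: "e \<in> E" for e
  proof (cases "s e * z e > 0")
    case True
    then have "t * (s e * z e) \<le> s e * v e"
      using le[of e] e unfolding pos_le_divide_eq[OF True] by blast
    then show ?thesis by (simp add: algebra_simps)
  next
    case False
    then have "t * (s e * z e) \<le> 0" using t by (simp add: mult_nonneg_nonpos)
    then show ?thesis using v(2)[OF e] by (simp add: algebra_simps)
  qed
  moreover have "s p \<noteq> 0" "z p \<noteq> 0" using p(1) by auto
  then have "v p - t * z p = 0" "v p \<noteq> 0"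
    using p(2) z(2) by (auto simp: supp_def)
  then have "supp (\<lambda>e. v e - t * z e) \<subset> supp v"
    using z(2) by (auto simp: supp_def)
  ultimately show ?thesis using t by blast
qed

text \<open>Nonnegativity on the elementary vectors of an orthant extends to all vectors of \<open>V\<close> there, as
  each is a conformal sum of elementary ones. The induction on the support avoids constructing that
  sum. A \<open>v\<close> that is not elementary has some \<open>z \<in> V\<close> with smaller support, and up to sign
  \<open>dot E w z \<ge> 0\<close>. Moving from \<open>v\<close> along \<open>- z\<close> until a coordinate vanishes does not increase
  \<open>dot E w\<close>. This is possible unless \<open>- z\<close> lies in the orthant, in which case the induction
  hypothesis for \<open>- z\<close> allows moving along \<open>z\<close> instead.\<close>

lemma nonneg_on_conformal:
  assumes elementary: "\<And>v. v \<in> support_minimal V \<Longrightarrow> (\<forall>e\<in>E. s e * v e \<ge> 0) \<Longrightarrow> dot E w v \<ge> 0"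
    and s: "\<And>e. e \<in> E \<Longrightarrow> s e \<noteq> 0"
    and v: "v \<in> V" "\<And>e. e \<in> E \<Longrightarrow> s e * v e \<ge> 0"
  shows "dot E w v \<ge> 0"
  using v
proof (induction "card (supp v)" arbitrary: v rule: less_induct)
  case less
  have smaller: "card (supp z) < card (supp v)" if "supp z \<subset> supp v" for z :: "'a \<Rightarrow> real"
    using that supp_V[OF less.prems(1)] finite_E by (meson finite_subset psubset_card_mono)
  consider "v \<in> support_minimal V" | "supp v = {}" |
    z where "z \<in> V" "supp z \<noteq> {}" "supp z \<subset> supp v"
    using less.prems(1) by (auto simp: support_minimal_def)
  then show ?case
  proof cases
    case 1
    then show ?thesis using elementary less.prems(2) by blast
  next
    case 2
    then show ?thesis by (simp add: dot_def supp_def)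
  next
    case (3 z)
    have dot_neg: "dot E w (\<lambda>e. - y e) = - dot E w y" for y
      by (simp add: dot_def sum_negf)
    have neg: "(\<lambda>e. - y e) \<in> V" if "y \<in> V" for y using V_scale[OF that, of "-1"] by simp
    have supp_neg: "supp (\<lambda>e. - y e) = supp y" for y :: "'a \<Rightarrow> real" by (auto simp: supp_def)
    obtain z1 where z1: "z1 \<in> V" "supp z1 \<noteq> {}" "supp z1 \<subset> supp v" "dot E w z1 \<ge> 0"
    proof (cases "dot E w z \<ge> 0")
      case False
      then show ?thesis using 3 neg[OF 3(1)] dot_neg[of z] by (intro that[of "\<lambda>e. - z e"]) (auto simp: supp_neg)
    qed (use that 3 in auto)
    have "\<exists>y e. y \<in> V \<and> supp y \<subset> supp v \<and> dot E w y \<ge> 0 \<and> e \<in> E \<and> s e * y e > 0"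
    proof (cases "\<exists>e\<in>E. s e * z1 e > 0")
      case False
      have "dot E w (\<lambda>e. - z1 e) \<ge> 0"
        by (rule less.hyps[OF smaller]) (use z1 neg False in \<open>auto simp: supp_neg not_less\<close>)
      moreover obtain e where e: "e \<in> E" "z1 e \<noteq> 0"
        using z1(2) supp_V[OF z1(1)] by (auto simp: supp_def)
      then have "s e * (- z1 e) > 0"
        using False s[OF e(1)] by (metis linorder_neqE_linordered_idom mult_eq_0_iff mult_minus_right neg_0_less_iff_less)
      ultimately show ?thesis
        using z1 neg e by (intro exI[of _ "\<lambda>e. - z1 e"] exI[of _ e]) (auto simp: supp_neg)
    qed (use z1 in auto)
    then obtain y e where y: "y \<in> V" "supp y \<subset> supp v" "dot E w y \<ge> 0" "e \<in> E" "s e * y e > 0"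
      by blast
    then obtain t where t: "t \<ge> 0" "\<forall>e\<in>E. s e * (v e - t * y e) \<ge> 0"
      "supp (\<lambda>e. v e - t * y e) \<subset> supp v"
      using reduce_support[OF less.prems y(1) _ y(4,5)] by blast
    have "dot E w (\<lambda>e. v e - t * y e) \<ge> 0"
      by (rule less.hyps[OF smaller])
        (use t V_add_scale[OF less.prems(1) y(1), of "-t"] in auto)
    moreover have "dot E w (\<lambda>e. v e - t * y e) = dot E w v - t * dot E w y"
      using dot_add_scale_right[of E w v "-t" y] by simp
    ultimately show ?thesis using t(1) y(3) by (smt (verit) mult_nonneg_nonneg)
  qed
qed


subsection \<open>Linear programming duality\<close>

text \<open>A solution is a point \<open>(x, y) = (w + u, w' + v)\<close> in the orthant of \<open>s\<close> with nonpositive duality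
  gap \<open>dot E x y\<close>. As \<open>dot E u v = 0\<close>, the gap is affine in \<open>(u, v)\<close>, so after homogenizing with a
  scale \<open>h > 0\<close> this is a system of linear inequalities to which Farkas' lemma applies. The system
  is self-dual: the multipliers \<open>P\<close>, \<open>D\<close>, \<open>g\<close> of an infeasible system satisfy \<open>p = P - g w' \<in> V\<close>,
  \<open>d = D - g w \<in> W\<close> and \<open>dot p w + dot d w' + g * dot w w' < 0\<close>. For \<open>g > 0\<close> the left-hand side is
  \<open>dot P D / g \<ge> 0\<close>; for \<open>g = 0\<close> it is nonnegative by the hypotheses on \<open>V\<close> and \<open>W\<close>.\<close>

lemma complementary_solutions:
  assumes feas: "\<And>v. v \<in> V \<Longrightarrow> (\<forall>e\<in>E. s e * v e \<ge> 0) \<Longrightarrow> dot E w v \<ge> 0"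
    and feas': "\<And>u. u \<in> W \<Longrightarrow> (\<forall>e\<in>E. s e * u e \<ge> 0) \<Longrightarrow> dot E w' u \<ge> 0"
    and s: "\<And>e. e \<in> E \<Longrightarrow> s e * s e = 1"
  shows "\<exists>x y. (\<lambda>e. x e - w e) \<in> W \<and> (\<lambda>e. y e - w' e) \<in> V \<and>
     (\<forall>e\<in>E. s e * x e \<ge> 0) \<and> (\<forall>e\<in>E. s e * y e \<ge> 0) \<and> dot E x y \<le> 0"
proof -
  define L where "L = (\<lambda>u v h k. case k of
      Primal e \<Rightarrow> s e * (h * w e + u e)
    | Dual e \<Rightarrow> s e * (h * w' e + v e)
    | Gap \<Rightarrow> - (h * dot E w w' + dot E u w' + dot E w v)
    | Scale \<Rightarrow> h)"
  define U where "U = {L u v h | u v h. u \<in> W \<and> v \<in> V}"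
  define I where "I = Primal ` E \<union> Dual ` E \<union> {Gap, Scale}"
  have sum_I: "(\<Sum>i\<in>I. l i * L u v h i) =
      dot E (\<lambda>e. l (Primal e) * s e) (\<lambda>e. h * w e + u e) +
      dot E (\<lambda>e. l (Dual e) * s e) (\<lambda>e. h * w' e + v e) -
      l Gap * (h * dot E w w' + dot E u w' + dot E w v) + l Scale * h" for l u v h
  proof -
    have "(\<Sum>i\<in>I. l i * L u v h i) = (\<Sum>i\<in>Primal ` E. l i * L u v h i) + (\<Sum>i\<in>Dual ` E. l i * L u v h i)
      + (l Gap * L u v h Gap + l Scale * L u v h Scale)"
      unfolding I_def using finite_E by (subst sum.union_disjoint, auto)+
    moreover have "(\<Sum>i\<in>Primal ` E. l i * L u v h i) = dot E (\<lambda>e. l (Primal e) * s e) (\<lambda>e. h * w e + u e)"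
      "(\<Sum>i\<in>Dual ` E. l i * L u v h i) = dot E (\<lambda>e. l (Dual e) * s e) (\<lambda>e. h * w' e + v e)"
      by (simp_all add: sum.reindex inj_on_def dot_def L_def mult.assoc)
    moreover have "L u v h Gap = - (h * dot E w w' + dot E u w' + dot E w v)" "L u v h Scale = h"
      by (simp_all add: L_def)
    ultimately show ?thesis by (simp only: mult_minus_right)
  qed
  note W_add = orthogonal_pair.V_add_scale[OF dual]
  show ?thesis
  proof (cases "\<exists>z\<in>U. (\<forall>i\<in>I. z i \<ge> 0) \<and> z Scale > 0")
    case True
    then obtain u v h where uv: "u \<in> W" "v \<in> V" "\<forall>i\<in>I. L u v h i \<ge> 0" "L u v h Scale > 0"
      unfolding U_def by blast
    have h: "h > 0" using uv(4) by (simp add: L_def)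
    define x where "x = (\<lambda>e. w e + inverse h * u e)"
    define y where "y = (\<lambda>e. w' e + inverse h * v e)"
    have "(\<lambda>e. x e - w e) \<in> W" "(\<lambda>e. y e - w' e) \<in> V"
      using V_scale[OF uv(2)] orthogonal_pair.V_scale[OF dual uv(1)] by (simp_all add: x_def y_def)
    moreover have "s e * x e \<ge> 0" "s e * y e \<ge> 0" if e: "e \<in> E" for e
    proof -
      have "L u v h (Primal e) \<ge> 0" "L u v h (Dual e) \<ge> 0" using uv(3) e by (auto simp: I_def)
      moreover have "s e * x e = inverse h * L u v h (Primal e)"
        "s e * y e = inverse h * L u v h (Dual e)"
        using h by (auto simp: x_def y_def L_def field_simps)
      ultimately show "s e * x e \<ge> 0" "s e * y e \<ge> 0" using h by simp_all
    qed
    moreover have "dot E x y = dot E w w' + inverse h * (dot E u w' + dot E w v)"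
      using orthogonal[OF uv(2,1)] dot_commute[of E u v]
      by (simp add: x_def y_def dot_add_scale_left dot_add_scale_right algebra_simps)
    then have "dot E x y = - (inverse h * L u v h Gap)"
      using h by (simp add: L_def field_simps)
    moreover have "L u v h Gap \<ge> 0" using uv(3) by (simp add: I_def)
    ultimately show ?thesis using h by (intro exI[of _ x] exI[of _ y]) auto
  next
    case False
    have "\<exists>l. (\<forall>i\<in>I. l i \<ge> 0) \<and> (\<forall>z\<in>U. z Scale + (\<Sum>i\<in>I. l i * z i) = 0)"
    proof (rule farkas_subspace)
      show "finite I" using finite_E by (simp add: I_def)
      show "z Scale \<le> 0" if "z \<in> U" "\<forall>i\<in>I. z i \<ge> 0" for z using False that by force
      show "subspace_like U"
        unfolding subspace_like_def
      proof (intro ballI allI)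
        fix x y t assume "x \<in> U" "y \<in> U"
        then obtain u v h u' v' h' where xy: "x = L u v h" "y = L u' v' h'"
          "u \<in> W" "v \<in> V" "u' \<in> W" "v' \<in> V" unfolding U_def by blast
        have "(\<lambda>i. x i + t * y i) = L (\<lambda>e. u e + t * u' e) (\<lambda>e. v e + t * v' e) (h + t * h')"
          unfolding xy(1,2) L_def
          by (auto simp: fun_eq_iff dot_add_scale_left dot_add_scale_right algebra_simps
              split: lp_coordinate.split)
        then show "(\<lambda>i. x i + t * y i) \<in> U"
          unfolding U_def using V_add_scale W_add xy(3-) by blast
      qed
    qed
    then obtain l where l: "\<forall>i\<in>I. l i \<ge> 0" "\<forall>z\<in>U. z Scale + (\<Sum>i\<in>I. l i * z i) = 0" by blast
    define g where "g = l Gap"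
    define p where "p = (\<lambda>e. if e \<in> E then l (Primal e) * s e - g * w' e else 0)"
    define d where "d = (\<lambda>e. if e \<in> E then l (Dual e) * s e - g * w e else 0)"
    have dots: "dot E (\<lambda>e. l (Primal e) * s e) z = dot E p z + g * dot E w' z"
      "dot E (\<lambda>e. l (Dual e) * s e) z = dot E d z + g * dot E w z" for z
      by (auto simp: dot_def p_def d_def sum_distrib_left algebra_simps simp flip: sum.distrib)
    have eq: "h + (h * dot E p w + dot E p u + g * (h * dot E w' w + dot E w' u) +
        (h * dot E d w' + dot E d v + g * (h * dot E w w' + dot E w v)) -
        g * (h * dot E w w' + dot E u w' + dot E w v) + l Scale * h) = 0"
      if "u \<in> W" "v \<in> V" for u v h
    proof -
      have "L u v h \<in> U" using that by (auto simp: U_def)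
      then have "L u v h Scale + (\<Sum>i\<in>I. l i * L u v h i) = 0" using l(2) by blast
      moreover have "dot E q (\<lambda>e. h * a e + b e) = h * dot E q a + dot E q b" for q a b
        using dot_add_scale_right[of E q b h a] by (simp add: add.commute)
      moreover have "L u v h Scale = h" by (simp add: L_def)
      ultimately show ?thesis unfolding sum_I dots g_def by simp
    qed
    note zeroW = orthogonal_pair.zero_in_V[OF dual]
    have z0: "dot E q (\<lambda>e. 0) = 0" "dot E (\<lambda>e. 0) q = 0" for q by (simp_all add: dot_def)
    have p: "p \<in> V" unfolding V_iff
      using eq[of _ "\<lambda>e. 0" 0] zero_in_V dot_commute[of E w']
      by (auto simp: p_def supp_def z0)
    have d: "d \<in> W" unfolding W_iff
      using eq[of "\<lambda>e. 0" _ 0] zeroW by (auto simp: d_def supp_def z0)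
    have neg: "dot E p w + dot E d w' + g * dot E w w' < 0"
    proof -
      have "l Scale \<ge> 0" using l(1) by (simp add: I_def)
      then show ?thesis
        using eq[OF zeroW zero_in_V, of 1] by (simp add: z0 dot_commute[of E w'] )
    qed
    have pd: "s e * (p e + g * w' e) \<ge> 0" "s e * (d e + g * w e) \<ge> 0" if e: "e \<in> E" for e
    proof -
      have "l (Primal e) \<ge> 0" "l (Dual e) \<ge> 0" using l(1) e by (auto simp: I_def)
      moreover have "s e * (p e + g * w' e) = (s e * s e) * l (Primal e)"
        "s e * (d e + g * w e) = (s e * s e) * l (Dual e)"
        using e by (auto simp: p_def d_def)
      ultimately show "s e * (p e + g * w' e) \<ge> 0" "s e * (d e + g * w e) \<ge> 0"
        using s[OF e] by simp_all
    qed
    have "g \<ge> 0" using l(1) by (simp add: g_def I_def)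
    then consider "g = 0" | "g > 0" by force
    then have False
    proof cases
      case 1
      then have "dot E w p \<ge> 0" "dot E w' d \<ge> 0" using feas[OF p] feas'[OF d] pd by auto
      then show False using neg 1 by (simp add: dot_commute[of E p] dot_commute[of E d])
    next
      case 2
      have "(p e + g * w' e) * (d e + g * w e) \<ge> 0" if e: "e \<in> E" for e
      proof -
        have "(p e + g * w' e) * (d e + g * w e) = (s e * s e) * ((p e + g * w' e) * (d e + g * w e))"
          using s[OF e] by simp
        also have "\<dots> = (s e * (p e + g * w' e)) * (s e * (d e + g * w e))" by (simp only: mult_ac)
        also have "\<dots> \<ge> 0" using pd[OF e] by simp
        finally show ?thesis .
      qed
      then have "0 \<le> dot E (\<lambda>e. p e + g * w' e) (\<lambda>e. d e + g * w e)"
        unfolding dot_def by (intro sum_nonneg) auto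
      also have "\<dots> = g * (dot E p w + dot E d w' + g * dot E w w')"
        using orthogonal[OF p d]
        by (simp add: dot_add_scale_left dot_add_scale_right algebra_simps dot_commute[of E w'])
      finally show False using neg 2 by (simp add: zero_le_mult_iff)
    qed
    then show ?thesis ..
  qed
qed

subsection \<open>Orientations and complementary pairs\<close>

text \<open>Nondegeneracy: an elementary \<open>z\<close> inside the zero set of \<open>x\<close> would give
  \<open>dot E w z = dot E x z = 0\<close>.\<close>

lemma independent_zero_set:
  assumes w: "inducing \<sigma> w" and x: "(\<lambda>e. x e - w e) \<in> W"
    and v: "v \<in> V" "supp v \<subseteq> {e\<in>E. x e = 0}"
  shows "supp v = {}"
proof (rule ccontr)
  assume "supp v \<noteq> {}"
  then obtain z where z: "z \<in> support_minimal V" "supp z \<subseteq> supp v"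
    using support_minimal_below[OF v(1)] by blast
  have "dot E x z = 0"
    unfolding dot_def using z(2) v(2) by (intro sum.neutral) (auto simp: supp_def)
  then have "dot E w z = 0" using dot_congruent[OF x] z(1) by (simp add: support_minimal_def)
  then show False using w z(1) by (simp add: inducing_def)
qed

text \<open>Complementary slackness with the signs of \<open>\<O>\<close>: \<open>x\<close> and \<open>y\<close> are the basic solutions of \<open>B\<close>
  for the two dual programs with right-hand sides \<open>w\<close> and \<open>w'\<close>, and \<open>\<O>\<close> records their signs on the
  complementary supports.\<close>

definition oriented_by_basis ::
    "('a \<Rightarrow> real) \<Rightarrow> ('a \<Rightarrow> real) \<Rightarrow> ('a \<Rightarrow> int) \<Rightarrow> 'a set \<Rightarrow> bool" where
  "oriented_by_basis w w' \<O> B \<longleftrightarrow> (\<exists>x y. (\<lambda>e. x e - w e) \<in> W \<and> (\<lambda>e. y e - w' e) \<in> V \<and>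
     (\<forall>e\<in>B. x e = 0 \<and> y e \<noteq> 0 \<and> \<O> e = sign_vec y e) \<and>
     (\<forall>e\<in>E-B. y e = 0 \<and> x e \<noteq> 0 \<and> \<O> e = sign_vec x e))"

text \<open>For \<open>e \<in> B2 - B1\<close> the product \<open>x1 e * y2 e\<close> is positive, as both factors have the sign of \<open>\<O> e\<close>.
  But all products \<open>x1 e * y2 e\<close> and \<open>x2 e * y1 e\<close> are nonnegative, and they sum to
  \<open>- dot E (x1 - x2) (y1 - y2) = 0\<close>.\<close>

lemma oriented_by_basis_subset:
  assumes "oriented_by_basis w w' \<O> B1" "oriented_by_basis w w' \<O> B2" "B1 \<subseteq> E" "B2 \<subseteq> E"
  shows "B2 \<subseteq> B1"
proof (rule ccontr)
  assume "\<not> B2 \<subseteq> B1"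
  then obtain f where f: "f \<in> B2" "f \<notin> B1" "f \<in> E" using assms by blast
  obtain x1 y1 where 1: "(\<lambda>e. x1 e - w e) \<in> W" "(\<lambda>e. y1 e - w' e) \<in> V"
     "\<And>e. e \<in> B1 \<Longrightarrow> x1 e = 0 \<and> y1 e \<noteq> 0 \<and> \<O> e = sign_vec y1 e"
     "\<And>e. e \<in> E-B1 \<Longrightarrow> y1 e = 0 \<and> x1 e \<noteq> 0 \<and> \<O> e = sign_vec x1 e"
    using assms(1) unfolding oriented_by_basis_def by blast
  obtain x2 y2 where 2: "(\<lambda>e. x2 e - w e) \<in> W" "(\<lambda>e. y2 e - w' e) \<in> V"
     "\<And>e. e \<in> B2 \<Longrightarrow> x2 e = 0 \<and> y2 e \<noteq> 0 \<and> \<O> e = sign_vec y2 e"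
     "\<And>e. e \<in> E-B2 \<Longrightarrow> y2 e = 0 \<and> x2 e \<noteq> 0 \<and> \<O> e = sign_vec x2 e"
    using assms(2) unfolding oriented_by_basis_def by blast
  have pos: "x1 e * y2 e > 0" if "e \<in> B2" "e \<in> E - B1" for e
    using 1(4)[OF that(2)] 2(3)[OF that(1)] sign_vec_eq_iff_mult_pos[of x1 e y2] by simp
  have pos': "x2 e * y1 e > 0" if "e \<in> B1" "e \<in> E - B2" for e
    using 2(4)[OF that(2)] 1(3)[OF that(1)] sign_vec_eq_iff_mult_pos[of x2 e y1] by simp
  have nn: "x1 e * y2 e \<ge> 0 \<and> x2 e * y1 e \<ge> 0 \<and> x1 e * y1 e = 0 \<and> x2 e * y2 e = 0" if "e \<in> E" for e
    using pos[of e] pos'[of e] 1(3,4)[of e] 2(3,4)[of e] that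
    by (cases "e \<in> B1"; cases "e \<in> B2") auto
  have "(\<lambda>e. x1 e - x2 e) \<in> W" "(\<lambda>e. y1 e - y2 e) \<in> V"
    using orthogonal_pair.V_diff[OF dual 1(1) 2(1)] V_diff[OF 1(2) 2(2)] by simp_all
  then have "0 = dot E (\<lambda>e. y1 e - y2 e) (\<lambda>e. x1 e - x2 e)" using orthogonal by simp
  also have "\<dots> = - (\<Sum>e\<in>E. x1 e * y2 e + x2 e * y1 e)"
    unfolding dot_def sum_negf[symmetric] 
  proof (rule sum.cong)
    show "(y1 e - y2 e) * (x1 e - x2 e) = - (x1 e * y2 e + x2 e * y1 e)" if "e \<in> E" for e
    proof -
      have "(y1 e - y2 e) * (x1 e - x2 e) = x1 e * y1 e + x2 e * y2 e - (x1 e * y2 e + x2 e * y1 e)"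
        by (simp add: algebra_simps)
      then show ?thesis using nn[OF that] by simp
    qed
  qed simp
  finally have "(\<Sum>e\<in>E. x1 e * y2 e + x2 e * y1 e) = 0" by simp
  moreover have "(\<Sum>e\<in>E. x1 e * y2 e + x2 e * y1 e) > 0"
    using pos[of f] f nn by (intro sum_pos2[OF finite_E f(3)]) (auto intro!: add_pos_nonneg)
  ultimately show False by simp
qed

text \<open>The basis is the zero set of \<open>x\<close> for a complementary pair \<open>(x, y)\<close>. If \<open>y\<close> also vanished
  at some \<open>e \<in> B\<close>, the fundamental cocircuit of \<open>e\<close> would lie in the zero set of \<open>y\<close>, against
  nondegeneracy.\<close>

lemma oriented_by_basis_exists:
  assumes w: "inducing \<sigma> w" and w': "orthogonal_pair.inducing E W \<sigma>' w'"
    and O: "\<And>e. e \<in> E \<Longrightarrow> \<O> e \<in> {-1, 1}"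
    and V: "\<And>v. v \<in> support_minimal V \<Longrightarrow> compatible \<O> (sign_vec v) \<Longrightarrow> dot E w v > 0"
    and W: "\<And>u. u \<in> support_minimal W \<Longrightarrow> compatible \<O> (sign_vec u) \<Longrightarrow> dot E w' u > 0"
  shows "\<exists>B. basis B \<and> oriented_by_basis w w' \<O> B"
proof -
  define s where "s = (\<lambda>e. real_of_int (\<O> e))"
  have s: "s e * s e = 1" "s e \<noteq> 0" if "e \<in> E" for e using O[OF that] by (auto simp: s_def)
  have conf: "sign_vec v e = \<O> e" if "e \<in> E" "s e * v e \<ge> 0" "v e \<noteq> 0" for v e
  proof -
    have "s e * v e > 0" using that s(2)[OF that(1)] by (simp add: order_less_le)
    then show ?thesis
      unfolding s_def using sign_vec_eq_orientation_iff[OF O[OF that(1)], of v e] by blast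
  qed
  have comp: "compatible \<O> (sign_vec v)" if "supp v \<subseteq> E" "\<forall>e\<in>E. s e * v e \<ge> 0" for v
    unfolding compatible_def supp_sign_vec
  proof
    fix e assume "e \<in> supp v"
    then have "e \<in> E" "v e \<noteq> 0" using that(1) by (auto simp: supp_def)
    then show "\<O> e = sign_vec v e" using conf[of e v] that(2) by simp
  qed
  have feas: "dot E w v \<ge> 0" if "v \<in> V" "\<forall>e\<in>E. s e * v e \<ge> 0" for v
  proof (rule nonneg_on_conformal[of s w v])
    fix z assume z: "z \<in> support_minimal V" "\<forall>e\<in>E. s e * z e \<ge> 0"
    then have "supp z \<subseteq> E" using supp_V by (simp add: support_minimal_def)
    then show "dot E w z \<ge> 0" using V[OF z(1) comp[OF _ z(2)]] by simp
  qed (use that s(2) in simp_all)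
  have feas': "dot E w' v \<ge> 0" if "v \<in> W" "\<forall>e\<in>E. s e * v e \<ge> 0" for v
  proof (rule orthogonal_pair.nonneg_on_conformal[OF dual, of s w' v])
    fix z assume z: "z \<in> support_minimal W" "\<forall>e\<in>E. s e * z e \<ge> 0"
    then have "supp z \<subseteq> E" using orthogonal_pair.supp_V[OF dual] by (simp add: support_minimal_def)
    then show "dot E w' z \<ge> 0" using W[OF z(1) comp[OF _ z(2)]] by simp
  qed (use that s(2) in simp_all)
  obtain x y where xy: "(\<lambda>e. x e - w e) \<in> W" "(\<lambda>e. y e - w' e) \<in> V"
     "\<forall>e\<in>E. s e * x e \<ge> 0" "\<forall>e\<in>E. s e * y e \<ge> 0" "dot E x y \<le> 0"
    using complementary_solutions[of s w w', OF feas feas' s(1)] by blast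
  have nn: "x e * y e \<ge> 0" if "e \<in> E" for e
  proof -
    have "x e * y e = (s e * s e) * (x e * y e)" using s[OF that] by simp
    also have "\<dots> = (s e * x e) * (s e * y e)" by (simp only: mult_ac)
    also have "\<dots> \<ge> 0" using xy that by simp
    finally show ?thesis .
  qed
  have "(\<Sum>e\<in>E. x e * y e) = 0"
    using xy(5) sum_nonneg[of E, OF nn] unfolding dot_def by (rule antisym)
  then have xy0: "x e = 0 \<or> y e = 0" if "e \<in> E" for e
    using sum_nonneg_eq_0_iff[OF finite_E nn] that by simp
  define B where "B = {e\<in>E. x e = 0}"
  have indep': "supp u = {}" if "u \<in> W" "supp u \<subseteq> {e\<in>E. y e = 0}" for u
    using orthogonal_pair.independent_zero_set[OF dual w' xy(2) that] .
  have "basis B"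
    unfolding basis_def
    using independent_zero_set[OF w xy(1)] indep' xy0 by (auto simp: B_def subset_iff)
  moreover have "y e \<noteq> 0" if "e \<in> B" for e
  proof
    assume "y e = 0"
    have "e \<in> E - (E - B)" using that by (simp add: B_def)
    then obtain u where u: "u \<in> W" "supp u \<subseteq> (E - B) \<union> {e}" "u e = 1"
      using orthogonal_pair.fundamental_vector[OF dual basis_dual[OF \<open>basis B\<close>]] by blast
    have "supp u \<subseteq> {e\<in>E. y e = 0}"
      using u(2) xy0 \<open>y e = 0\<close> that by (auto simp: B_def)
    then have "supp u = {}" by (rule indep'[OF u(1)])
    then show False using u(3) by (auto simp: supp_def)
  qed
  then have "oriented_by_basis w w' \<O> B"
    unfolding oriented_by_basis_def using xy xy0 conf
    by (intro exI[of _ x] exI[of _ y]) (auto simp: B_def)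
  ultimately show ?thesis by blast
qed

lemma compatible_of_oriented_by_basis:
  assumes w: "inducing \<sigma> w" and w': "orthogonal_pair.inducing E W \<sigma>' w'"
    and O: "oriented_by_basis w w' \<O> B" 
  shows "v \<in> support_minimal V \<Longrightarrow> compatible \<O> (sign_vec v) \<Longrightarrow> dot E w v > 0"
    and "u \<in> support_minimal W \<Longrightarrow> compatible \<O> (sign_vec u) \<Longrightarrow> dot E w' u > 0"
proof -
  obtain x y where xy: "(\<lambda>e. x e - w e) \<in> W" "(\<lambda>e. y e - w' e) \<in> V"
     "\<And>e. e \<in> B \<Longrightarrow> x e = 0 \<and> y e \<noteq> 0 \<and> \<O> e = sign_vec y e"
     "\<And>e. e \<in> E-B \<Longrightarrow> y e = 0 \<and> x e \<noteq> 0 \<and> \<O> e = sign_vec x e"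
    using O unfolding oriented_by_basis_def by blast
  show "dot E w v > 0" if "v \<in> support_minimal V" "compatible \<O> (sign_vec v)"
    using compatible_of_representative[OF w xy(1) _ that] xy(3,4) by blast
  show "dot E w' u > 0" if "u \<in> support_minimal W" "compatible \<O> (sign_vec u)"
    using orthogonal_pair.compatible_of_representative[OF dual w' xy(2) _ that] xy(3,4) by blast
qed

end

section \<open>Kernel, row space and bases of a matrix\<close>

text \<open>The substantial part is that a vector \<open>u\<close> orthogonal to the kernel is a combination of the
  rows: the functional \<open>dot E u\<close> vanishes where all rows vanish, so it lies in their span.\<close>

lemma orthogonal_pair_kernel_row_space:
  assumes "finite E"
  shows "orthogonal_pair E (matrix_kernel r E A) (row_space r E A)"
proof
  let ?V = "matrix_kernel r E A" and ?W = "row_space r E A"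
  have comb: "(\<Sum>e\<in>E. v e * (\<Sum>i<r. c i * A i e)) = (\<Sum>i<r. c i * (\<Sum>e\<in>E. A i e * v e))" for v c
    unfolding sum_distrib_left by (subst sum.swap) (simp add: mult_ac)
  have orth: "dot E v u = 0" if "v \<in> ?V" "u \<in> ?W" for v u
  proof -
    obtain c where c: "\<forall>e\<in>E. u e = (\<Sum>i<r. c i * A i e)" using \<open>u \<in> ?W\<close> unfolding row_space_def by blast
    then have "dot E v u = (\<Sum>e\<in>E. v e * (\<Sum>i<r. c i * A i e))" by (simp add: dot_def)
    also have "\<dots> = 0" unfolding comb using that(1) by (simp add: matrix_kernel_def)
    finally show ?thesis .
  qed
  have row_space_supp: "supp u \<subseteq> E" if "u \<in> ?W" for u using that by (simp add: row_space_def)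
  show "v \<in> ?V \<longleftrightarrow> supp v \<subseteq> E \<and> (\<forall>u\<in>?W. dot E v u = 0)" for v
  proof
    assume v: "supp v \<subseteq> E \<and> (\<forall>u\<in>?W. dot E v u = 0)"
    have "(\<Sum>e\<in>E. A i e * v e) = 0" if i: "i < r" for i
    proof -
      let ?u = "\<lambda>e. if e \<in> E then A i e else 0"
      have "?u \<in> ?W"
        unfolding row_space_def using i
        by (auto simp: supp_def if_distrib[of "\<lambda>t. t * _"] cong: if_cong
            intro!: exI[of _ "\<lambda>k. if k = i then 1 else 0"])
      then have "dot E v ?u = 0" using v by blast
      then show ?thesis by (simp add: dot_def mult.commute)
    qed
    then show "v \<in> ?V" using v by (simp add: matrix_kernel_def)
  qed (use orth in \<open>auto simp: matrix_kernel_def\<close>)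
  show "u \<in> ?W \<longleftrightarrow> supp u \<subseteq> E \<and> (\<forall>v\<in>?V. dot E u v = 0)" for u
  proof
    assume u: "supp u \<subseteq> E \<and> (\<forall>v\<in>?V. dot E u v = 0)"
    \<comment> \<open>Index \<open>r\<close> is the first one not used by a row; it holds the functional \<open>dot E u\<close>.\<close>
    let ?z = "\<lambda>x i. if i < r then dot E (A i) x else dot E u x"
    have "\<exists>c. \<forall>z\<in>range ?z. z r = (\<Sum>i<r. c i * z i)"
    proof (rule coordinate_in_span)
      show "subspace_like (range ?z)"
        unfolding subspace_like_def
      proof (intro ballI allI)
        fix x y t assume "x \<in> range ?z" "y \<in> range ?z"
        then obtain a b where "x = ?z a" "y = ?z b" by blast
        then have "(\<lambda>i. x i + t * y i) = ?z (\<lambda>e. a e + t * b e)"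
          by (auto simp: fun_eq_iff dot_add_scale_right)
        then show "(\<lambda>i. x i + t * y i) \<in> range ?z" by blast
      qed
      fix z assume "z \<in> range ?z" and 0: "\<forall>i\<in>{..<r}. z i = 0"
      then obtain x where x: "z = ?z x" by blast
      let ?x = "\<lambda>e. if e \<in> E then x e else 0"
      have x_E: "dot E q ?x = dot E q x" for q by (simp add: dot_def)
      have "dot E (A i) ?x = 0" if "i < r" for i
        using 0 that unfolding x_E x by auto
      then have "?x \<in> ?V"
        unfolding matrix_kernel_def dot_def by (auto simp: supp_def)
      then have "dot E u ?x = 0" using u by blast
      then show "z r = 0" by (simp add: x x_E)
    qed simp
    then obtain c where "\<forall>z\<in>range ?z. z r = (\<Sum>i<r. c i * z i)" by blast
    then have c: "dot E u x = (\<Sum>i<r. c i * dot E (A i) x)" for x by simp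
    have "u e = (\<Sum>i<r. c i * A i e)" if "e \<in> E" for e
      using c[of "\<lambda>f. if f = e then 1 else 0"] that assms by (simp add: dot_indicator)
    then show "u \<in> ?W" using u by (auto simp: row_space_def)
  qed (use orth dot_commute[of E u] row_space_supp in fastforce)
qed (rule assms)

lemma columns_independent_iff:
  assumes "finite E" "B \<subseteq> E"
  shows "columns_independent r A B \<longleftrightarrow> (\<forall>v\<in>matrix_kernel r E A. supp v \<subseteq> B \<longrightarrow> supp v = {})"
proof -
  have restrict: "(\<Sum>e\<in>E. A i e * v e) = (\<Sum>e\<in>B. v e * A i e)" if "supp v \<subseteq> B" for v i
    using assms that by (subst sum.mono_neutral_right[of E B]) (auto simp: supp_def mult.commute)
  show ?thesis
  proof
    assume ind: "columns_independent r A B"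
    show "\<forall>v\<in>matrix_kernel r E A. supp v \<subseteq> B \<longrightarrow> supp v = {}"
    proof (intro ballI impI)
      fix v assume v: "v \<in> matrix_kernel r E A" "supp v \<subseteq> B"
      then have "\<forall>e\<in>B. v e = 0"
        using ind restrict[OF v(2)] by (auto simp: columns_independent_def matrix_kernel_def)
      then show "supp v = {}" using v(2) by (auto simp: supp_def)
    qed
  next
    assume ker: "\<forall>v\<in>matrix_kernel r E A. supp v \<subseteq> B \<longrightarrow> supp v = {}"
    show "columns_independent r A B"
      unfolding columns_independent_def
    proof (intro allI impI)
      fix x assume x: "\<forall>i<r. (\<Sum>e\<in>B. x e * A i e) = 0"
      let ?v = "\<lambda>e. if e \<in> B then x e else 0"
      have sv: "supp ?v \<subseteq> B" by (auto simp: supp_def)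
      then have "?v \<in> matrix_kernel r E A"
        using x assms restrict[OF sv] by (auto simp: matrix_kernel_def)
      then have "supp ?v = {}" using ker sv by blast
      then show "\<forall>e\<in>B. x e = 0" by (auto simp: supp_def split: if_splits)
    qed
  qed
qed

text \<open>A maximal independent set \<open>B\<close> is spanning: for \<open>u \<in> W\<close> supported off \<open>B\<close> with \<open>u e \<noteq> 0\<close>, a
  dependency on \<open>B \<union> {e}\<close> would meet \<open>u\<close> only in \<open>e\<close> and not be orthogonal to it. Conversely, a
  fundamental vector shows that no set containing \<open>B\<close> properly is independent.\<close>

lemma bases_iff_basis:
  assumes "finite E"
  shows "B \<in> bases r E A \<longleftrightarrow> orthogonal_pair.basis E (matrix_kernel r E A) (row_space r E A) B"
proof -
  let ?V = "matrix_kernel r E A" and ?W = "row_space r E A"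
  interpret orthogonal_pair E ?V ?W by (rule orthogonal_pair_kernel_row_space[OF assms])
  note ind_iff = columns_independent_iff[OF assms, where r = r and A = A]
  show ?thesis
  proof
    assume B: "B \<in> bases r E A"
    then have BE: "B \<subseteq> E" and "columns_independent r A B" by (simp_all add: bases_def)
    then have ind: "\<forall>v\<in>?V. supp v \<subseteq> B \<longrightarrow> supp v = {}" using ind_iff by blast
    have "supp u = {}" if u: "u \<in> ?W" "supp u \<subseteq> E - B" for u
    proof (rule ccontr)
      assume "supp u \<noteq> {}"
      then obtain e where e: "u e \<noteq> 0" "e \<in> E - B" using u by (auto simp: supp_def)
      have "\<not> columns_independent r A (insert e B)" using B e by (auto simp: bases_def)
      then obtain v where v: "v \<in> ?V" "supp v \<subseteq> insert e B" "supp v \<noteq> {}"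
        using e BE by (auto simp: ind_iff)
      then have ve: "v e \<noteq> 0" using ind by (auto simp: supp_def)
      have "dot E v u = v e * u e"
        by (rule dot_single[OF assms]) (use e v(2) u(2) in \<open>auto simp: supp_def\<close>)
      then show False using orthogonal[OF v(1) u(1)] ve e by simp
    qed
    then show "basis B" using BE ind by (simp add: basis_def)
  next
    assume B: "basis B"
    have "B' = B" if B': "B \<subseteq> B'" "B' \<subseteq> E" "columns_independent r A B'" for B'
    proof (rule ccontr)
      assume "B' \<noteq> B"
      then obtain e where e: "e \<in> B'" "e \<in> E - B" using B' by blast
      obtain v where "v \<in> ?V" "supp v \<subseteq> B \<union> {e}" and "v e = 1"
        using fundamental_vector[OF B e(2)] by blast
      moreover have "B \<union> {e} \<subseteq> B'" using B' e by blast
      ultimately have "supp v = {}" using B'(3) ind_iff[OF B'(2)] by blast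
      then show False using \<open>v e = 1\<close> by (simp add: supp_def)
    qed
    moreover have "B \<subseteq> E" "columns_independent r A B"
      using B ind_iff[of B] by (simp_all add: basis_def)
    ultimately show "B \<in> bases r E A" unfolding bases_def by blast
  qed
qed

section \<open>The bijection\<close>

theorem theorem1p4p1:
  fixes E :: "'a set" and r :: nat and A :: "nat \<Rightarrow> 'a \<Rightarrow> real"
    and \<sigma> \<sigma>' :: "'a set \<Rightarrow> 'a \<Rightarrow> int"
  assumes "finite E"
    and "matrix_rank r E A = r"
    and "signature_of (signed_circuits r E A) \<sigma>"
    and "acyclic_signature (matrix_kernel r E A) (circuits r E A) \<sigma>"
    and "signature_of (signed_cocircuits r E A) \<sigma>'"
    and "acyclic_signature (row_space r E A) (cocircuits r E A) \<sigma>'"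
  shows "bij_betw (beta_hat r E A \<sigma> \<sigma>') (bases r E A) (compatible_orientations r E A \<sigma> \<sigma>')"
proof -
  let ?V = "matrix_kernel r E A" and ?W = "row_space r E A"
  interpret orthogonal_pair E ?V ?W by (rule orthogonal_pair_kernel_row_space[OF assms(1)])
  interpret D: orthogonal_pair E ?W ?V by (rule dual)
  note circ = signed_circuits_def signed_cocircuits_def circuits_def cocircuits_def
  have sig: "signature_of (sign_vec ` support_minimal ?V) \<sigma>"
    and sig': "signature_of (sign_vec ` support_minimal ?W) \<sigma>'"
    using assms by (simp_all only: circ)
  obtain w where w: "inducing \<sigma> w"
    using acyclic_signature_induced[OF sig] assms(4) by (auto simp only: circ)
  obtain w' where w': "D.inducing \<sigma>' w'"
    using D.acyclic_signature_induced[OF sig'] assms(6) by (auto simp only: circ)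
  let ?\<beta> = "beta_hat r E A \<sigma> \<sigma>'"
  have beta: "?\<beta> B e = (if e \<in> B then \<sigma>' (fundamental ?W (E - B) e) e else \<sigma> (fundamental ?V B e) e)"
    if "e \<in> E" for B e
    using that by (simp add: beta_hat_def fund_circuit_def fund_cocircuit_def fundamental_def circ)
  have mem: "\<O> \<in> compatible_orientations r E A \<sigma> \<sigma>' \<longleftrightarrow> \<O> \<in> orientations E \<and>
      (\<forall>v\<in>support_minimal ?V. compatible \<O> (sign_vec v) \<longrightarrow> dot E w v > 0) \<and>
      (\<forall>u\<in>support_minimal ?W. compatible \<O> (sign_vec u) \<longrightarrow> dot E w' u > 0)" for \<O>
    unfolding compatible_orientations_def circ mem_Collect_eq
    using compatible_circuits_iff[OF sig w] D.compatible_circuits_iff[OF sig' w'] by simp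
  have oriented_iff: "?\<beta> B = \<O> \<longleftrightarrow> oriented_by_basis w w' \<O> B"
    if B: "basis B" and O: "\<O> \<in> extensional E" for B \<O>
  proof -
    have BE: "B \<subseteq> E" using B by (simp add: basis_def)
    note B' = basis_dual[OF B]
    have signs: "(\<forall>e\<in>B. y e \<noteq> 0 \<and> ?\<beta> B e = sign_vec y e) \<and> (\<forall>e\<in>E - B. x e \<noteq> 0 \<and> ?\<beta> B e = sign_vec x e)"
      if x: "(\<lambda>e. x e - w e) \<in> ?W" "\<forall>e\<in>B. x e = 0"
        and y: "(\<lambda>e. y e - w' e) \<in> ?V" "\<forall>e\<in>E - B. y e = 0" for x y
      using signature_of_fundamental[OF sig w B x(1)] x(2)
        D.signature_of_fundamental[OF sig' w' B' y(1)] y(2) BE beta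
      by (auto simp: double_diff)
    show ?thesis
    proof
      assume "?\<beta> B = \<O>"
      moreover obtain x where "(\<lambda>e. x e - w e) \<in> ?W" "\<forall>e\<in>B. x e = 0"
        using basis_representative[OF B] by blast
      moreover obtain y where "(\<lambda>e. y e - w' e) \<in> ?V" "\<forall>e\<in>E - B. y e = 0"
        using D.basis_representative[OF B'] by blast
      ultimately show "oriented_by_basis w w' \<O> B"
        unfolding oriented_by_basis_def using signs by blast
    next
      assume "oriented_by_basis w w' \<O> B"
      then obtain x y where "(\<lambda>e. x e - w e) \<in> ?W" "(\<lambda>e. y e - w' e) \<in> ?V"
        "\<forall>e\<in>B. x e = 0 \<and> y e \<noteq> 0 \<and> \<O> e = sign_vec y e"
        "\<forall>e\<in>E-B. y e = 0 \<and> x e \<noteq> 0 \<and> \<O> e = sign_vec x e"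
        unfolding oriented_by_basis_def by blast
      then have "?\<beta> B e = \<O> e" if "e \<in> E" for e
        using signs[of x y] that by (cases "e \<in> B") auto
      then show "?\<beta> B = \<O>"
        using O by (intro extensionalityI[of _ E]) (auto simp: beta_hat_def)
    qed
  qed
  have beta_ext: "?\<beta> B \<in> extensional E" for B by (simp add: beta_hat_def)
  have beta_oriented: "oriented_by_basis w w' (?\<beta> B) B" if "basis B" for B
    using oriented_iff[OF that beta_ext[of B]] by simp
  have bases: "B \<in> bases r E A \<longleftrightarrow> basis B" for B by (rule bases_iff_basis[OF assms(1)])
  show ?thesis
    unfolding bij_betw_def
  proof
    show "inj_on ?\<beta> (bases r E A)"
    proof (rule inj_onI)
      fix B1 B2 assume B: "B1 \<in> bases r E A" "B2 \<in> bases r E A" and eq: "?\<beta> B1 = ?\<beta> B2"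
      then have "oriented_by_basis w w' (?\<beta> B1) B1" "oriented_by_basis w w' (?\<beta> B1) B2"
        using beta_oriented[of B1] beta_oriented[of B2] bases by simp_all
      moreover have "B1 \<subseteq> E" "B2 \<subseteq> E" using B by (auto simp: bases_def)
      ultimately show "B1 = B2" using oriented_by_basis_subset by blast
    qed
    show "?\<beta> ` bases r E A = compatible_orientations r E A \<sigma> \<sigma>'"
    proof (intro equalityI subsetI)
      fix \<O> assume "\<O> \<in> ?\<beta> ` bases r E A"
      then obtain B where B: "basis B" "\<O> = ?\<beta> B" using bases by blast
      then have O: "oriented_by_basis w w' \<O> B" using beta_oriented by simp
      have "\<O> e \<in> {-1, 1}" if "e \<in> E" for e
        using O that unfolding oriented_by_basis_def
        by (cases "e \<in> B") (fastforce simp: sign_vec_def)+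
      then have "\<O> \<in> orientations E"
        using beta_ext B(2) by (auto simp: orientations_def PiE_def)
      then show "\<O> \<in> compatible_orientations r E A \<sigma> \<sigma>'"
        unfolding mem using compatible_of_oriented_by_basis[OF w w' O] by blast
    next
      fix \<O> assume O: "\<O> \<in> compatible_orientations r E A \<sigma> \<sigma>'"
      then have ext: "\<O> \<in> extensional E" and pm: "\<And>e. e \<in> E \<Longrightarrow> \<O> e \<in> {-1, 1}"
        unfolding mem orientations_def by (auto simp: PiE_def)
      obtain B where B: "basis B" "oriented_by_basis w w' \<O> B"
        using oriented_by_basis_exists[of \<sigma> w \<sigma>' w' \<O>, OF w w' pm] O unfolding mem by blast
      then have "?\<beta> B = \<O>" using oriented_iff[OF B(1) ext] by simp
      then show "\<O> \<in> ?\<beta> ` bases r E A" using B(1) bases by blast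
    qed
  qed
qed

end
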